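(* Let $n$ be a positive integer, let $A, B\in \mathbb{C}^{n\times n}$ and let $C=A+B$. Then $$|\sigma(C)|\leq (2r(B)+1)|\sigma(A)|-|\sigma(A)\setminus \sigma(C)|.$$
   Context: For $M\in\mathbb{C}^{n\times n}$: $r(M)$ is the rank of $M$; $\sigma(M)$ is the set of distinct singular values of $M$ (the nonnegative square roots of the eigenvalues of $M^*M$, where $M^*$ is the conjugate transpose, including $0$ if $M$ is singular); $|\cdot|$ denotes the cardinality of a finite set. *)

theory Defs
  imports "Jordan_Normal_Form.DL_Rank" "Jordan_Normal_Form.Spectral_Radius"
begin

definition singular_values :: "complex mat \<Rightarrow> real set" where
  "singular_values M =
     {s. 0 \<le> s \<and> eigenvalue (mat_adjoint M * M) (complex_of_real (s\<^sup>2))}"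

text \<open>The set is finite, so the cardinalities of such sets are genuine.\<close>

lemma finite_singular_values:
  assumes M: "M \<in> carrier_mat n n"
  shows "finite (singular_values M)"
proof -
  have "mat_adjoint M \<in> carrier_mat n n"
    using M by (auto simp: mat_adjoint_def)
  then have "mat_adjoint M * M \<in> carrier_mat n n"
    using M by simp
  then have fin: "finite (spectrum (mat_adjoint M * M))"
    by (rule card_finite_spectrum(1))
  have inj: "inj_on (\<lambda>s. complex_of_real (s\<^sup>2)) (singular_values M)"
    by (rule inj_onI) (simp add: singular_values_def del: of_real_power)
  have "(\<lambda>s. complex_of_real (s\<^sup>2)) ` singular_values M
          \<subseteq> spectrum (mat_adjoint M * M)"
    by (auto simp: singular_values_def spectrum_def)
  with fin have "finite ((\<lambda>s. complex_of_real (s\<^sup>2)) ` singular_values M)"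
    by (rule rev_finite_subset)
  with inj show ?thesis
    by (simp add: finite_image_iff)
qed

end

theory Submission
  imports Defs
begin

text \<open>Singular values are compared through quadratic polynomials. Let \<open>q\<close> be a real polynomial of degree
  at most 2 that is nonnegative on the spectrum of a Hermitian \<open>H\<close>, and suppose that the forms of
  \<open>q(H)\<close> and \<open>q(K)\<close> agree on a subspace of codimension at most \<open>k\<close>. Then \<open>q < 0\<close> at no more than
  \<open>k\<close> eigenvalues of \<open>K\<close>. Take \<open>H = A\<^sup>*A\<close> and \<open>K = C\<^sup>*C\<close>. On \<open>ker B\<close> one has \<open>Ax = Cx\<close>, so linear \<open>q\<close>
  bound the number of singular values of \<open>C\<close> above, and below, all those of \<open>A\<close> by \<open>r(B)\<close>. The matrix
  \<open>C\<^sup>*C - A\<^sup>*A = B\<^sup>*C + A\<^sup>*B\<close> has rank at most \<open>2r(B)\<close>, so \<open>q(t) = (t - a\<^sup>2)(t - b\<^sup>2)\<close> shows that at most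
  \<open>2r(B)\<close> lie strictly between consecutive singular values \<open>a < b\<close> of \<open>A\<close>. In total
  \<open>\<sigma>(C) - \<sigma>(A)\<close> has at most \<open>2r(B)|\<sigma>(A)|\<close> elements.\<close>

section \<open>Algebra of the conjugate transpose\<close>

lemma mat_adjoint_dim[simp]:
  "dim_row (mat_adjoint A) = dim_col A" "dim_col (mat_adjoint A) = dim_row A"
  by (auto simp: mat_adjoint_def)

lemma mat_adjoint_carrier[simp]:
  "mat_adjoint A \<in> carrier_mat m n \<longleftrightarrow> A \<in> carrier_mat n m"
  unfolding carrier_mat_def mem_Collect_eq mat_adjoint_dim by (rule conj_commute)

lemma index_mat_adjoint[simp]:
  "i < dim_col A \<Longrightarrow> j < dim_row A \<Longrightarrow> mat_adjoint A $$ (i,j) = conjugate (A $$ (j,i))"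
  by (auto simp: mat_adjoint_def mat_of_rows_index)

lemma row_mat_adjoint[simp]:
  "i < dim_col A \<Longrightarrow> row (mat_adjoint A) i = conjugate (col A i)"
  by (rule eq_vecI) auto

lemma mat_adjoint_mat_adjoint[simp]: "mat_adjoint (mat_adjoint A) = A"
  by (rule eq_matI) auto

lemma mat_adjoint_one[simp]: "mat_adjoint (1\<^sub>m n :: complex mat) = 1\<^sub>m n"
  by (rule eq_matI) auto

lemma mat_adjoint_zero[simp]:
  "mat_adjoint (0\<^sub>m n m :: 'a :: conjugatable_field mat) = 0\<^sub>m m n"
  by (rule eq_matI) auto

lemma mat_adjoint_mult:
  fixes A B :: "'a :: conjugatable_field mat"
  assumes "A \<in> carrier_mat n m" "B \<in> carrier_mat m k"
  shows "mat_adjoint (A * B) = mat_adjoint B * mat_adjoint A"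
  by (rule eq_matI) (use assms in \<open>auto simp: scalar_prod_def sum_conjugate conjugate_dist_mul mult.commute\<close>)

lemma mat_adjoint_add:
  fixes A B :: "'a :: conjugatable_field mat"
  assumes "A \<in> carrier_mat n m" "B \<in> carrier_mat n m"
  shows "mat_adjoint (A + B) = mat_adjoint A + mat_adjoint B"
  by (rule eq_matI) (use assms in \<open>auto simp: conjugate_dist_add\<close>)

lemma mult_mat_vec_cscalar_prod:
  fixes A :: "'a :: conjugatable_field mat"
  assumes A: "A \<in> carrier_mat n m" and x: "x \<in> carrier_vec m" and y: "y \<in> carrier_vec n"
  shows "(A *\<^sub>v x) \<bullet>c y = x \<bullet>c (mat_adjoint A *\<^sub>v y)"
proof -
  have "(A *\<^sub>v x) \<bullet>c y = (\<Sum>i<n. \<Sum>j<m. A $$ (i,j) * x $ j * conjugate (y $ i))"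
    using A x y by (auto simp: scalar_prod_def sum_distrib_right atLeast0LessThan intro!: sum.cong)
  also have "\<dots> = (\<Sum>j<m. \<Sum>i<n. A $$ (i,j) * x $ j * conjugate (y $ i))"
    by (rule sum.swap)
  also have "\<dots> = x \<bullet>c (mat_adjoint A *\<^sub>v y)"
    using A x y by (auto simp: scalar_prod_def sum_distrib_left sum_conjugate conjugate_dist_mul
        atLeast0LessThan ac_simps intro!: sum.cong)
  finally show ?thesis .
qed

section \<open>Homogeneous linear systems and rank factorization\<close>

text \<open>Padding \<open>L\<close> with zero rows gives a singular square matrix, and
  \<open>x\<close> is a kernel vector. The dimension count is phrased with lists of functionals in
  place of subspaces; the pairing \<open>r \<bullet> x\<close> is bilinear, without
  conjugation.\<close>

lemma exists_nonzero_annihilated: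
  fixes L :: "'a :: field vec list"
  assumes len: "length L < n" and L: "set L \<subseteq> carrier_vec n"
  shows "\<exists>x \<in> carrier_vec n. x \<noteq> 0\<^sub>v n \<and> (\<forall>r \<in> set L. r \<bullet> x = 0)"
proof -
  define R where "R = L @ replicate (n - length L) (0\<^sub>v n)"
  define M where "M = mat_of_rows n R"
  have lenR: "length R = n" using len by (simp add: R_def)
  have R: "set R \<subseteq> carrier_vec n" using L by (auto simp: R_def)
  have M: "M \<in> carrier_mat n n" by (rule carrier_matI) (use lenR in \<open>auto simp: M_def\<close>)
  \<comment> \<open>As \<open>length L < n\<close>, at least one padding row is present, so the last
    row is zero.\<close>
  have "M = mat\<^sub>r n n (\<lambda>i. if i = n - 1 then 0\<^sub>v n else R ! i)"
    by (rule eq_matI) (use len lenR in \<open>auto simp: M_def mat_of_rows_def R_def nth_append\<close>)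
  also have "det \<dots> = 0"
    by (rule det_row_0) (use len lenR R in \<open>auto simp: subset_iff\<close>)
  finally have "det M = 0" .
  then obtain x where x: "x \<in> carrier_vec n" "x \<noteq> 0\<^sub>v n" "M *\<^sub>v x = 0\<^sub>v n"
    using det_0_iff_vec_prod_zero[OF M] by auto
  have "r \<bullet> x = 0" if "r \<in> set L" for r
  proof -
    from that have "r \<in> set R" by (simp add: R_def)
    then obtain i where i: "i < n" "r = R ! i" using lenR by (auto simp: in_set_conv_nth)
    have "r = row M i"
      unfolding M_def i(2) by (rule mat_of_rows_row[symmetric]) (use i lenR R in \<open>auto simp: subset_iff\<close>)
    then have "r \<bullet> x = (M *\<^sub>v x) $ i" using i M by auto
    then show ?thesis using x i by simp
  qed
  then show ?thesis using x by blast
qed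

text \<open>The columns of \<open>X\<close> are a maximal independent set of columns of
  \<open>A\<close>, and \<open>Y\<close> holds the coefficients of all columns in terms of them.
  Applied to \<open>B\<close>, the rows of \<open>Y\<close> are \<open>r(B)\<close> functionals
  whose common zeros lie in the kernel of \<open>B\<close>.\<close>

lemma (in vec_space) rank_factorization:
  assumes A: "A \<in> carrier_mat n nc"
  shows "\<exists>X Y. X \<in> carrier_mat n (rank A) \<and> Y \<in> carrier_mat (rank A) nc \<and> A = X * Y"
proof -
  have cols: "set (cols A) \<subseteq> carrier_vec n" using cols_dim A by blast
  obtain S where S: "finite S" "maximal S (\<lambda>T. T \<subseteq> set (cols A) \<and> lin_indpt T)"
    using maximal_exists_superset[of "set (cols A)" "\<lambda>T. T \<subseteq> set (cols A) \<and> lin_indpt T" "{}"]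
    by (auto simp: lin_dep_def)
  then have Ssub: "S \<subseteq> set (cols A)" and ind: "lin_indpt S" by (auto simp: maximal_def)
  have Scar: "S \<subseteq> carrier_vec n" using Ssub cols by auto
  have rk: "rank A = card S" by (rule rank_card_indpt[OF A S(2)])
  obtain ss where ss: "set ss = S" "distinct ss" using finite_distinct_list[OF S(1)] by blast
  then have len: "length ss = rank A" using rk distinct_card by force
  define X where "X = mat_of_cols n ss"
  have X: "X \<in> carrier_mat n (rank A)" unfolding X_def using len by auto
  have colsX: "cols X = ss" unfolding X_def using Scar ss by simp
  have "\<exists>y \<in> carrier_vec (rank A). col A j = X *\<^sub>v y" if j: "j < nc" for j
  proof -
    have cj: "col A j \<in> set (cols A)" using j A by (metis carrier_matD(2) cols_length cols_nth nth_mem)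
    have "col A j \<in> span S"
    \<comment> \<open>A column outside the span could be added to \<open>S\<close> without losing
      independence, against maximality.\<close>
    proof (rule ccontr)
      assume n: "col A j \<notin> span S"
      then have "col A j \<notin> S" using Scar in_own_span by auto
      moreover have "lin_indpt (S \<union> {col A j})"
        using lin_dep_iff_in_span[of S "col A j"] ind n Scar cj cols \<open>col A j \<notin> S\<close> by auto
      ultimately show False using S(2) cj Ssub unfolding maximal_def by blast
    qed
    then obtain a where "col A j = lincomb a (set (cols X))"
      using finite_span[OF S(1)] Scar ss colsX by auto
    also have "\<dots> = X *\<^sub>v vec (rank A) (\<lambda>i. a (col X i))"
      by (rule mat_mult_eq_lincomb[OF X, symmetric]) (simp add: colsX ss)
    finally show ?thesis by (metis vec_carrier)
  qed
  then obtain y where y: "\<And>j. j < nc \<Longrightarrow> y j \<in> carrier_vec (rank A)"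
    "\<And>j. j < nc \<Longrightarrow> col A j = X *\<^sub>v y j" by metis
  define Y where "Y = mat_of_cols (rank A) (map y [0..<nc])"
  have Y: "Y \<in> carrier_mat (rank A) nc" by (rule carrier_matI) (auto simp: Y_def)
  have "A = X * Y"
  proof (rule mat_col_eqI)
    fix j assume "j < dim_col (X * Y)"
    then have j: "j < nc" using Y by auto
    have "col Y j = y j" unfolding Y_def using j y by (subst col_mat_of_cols) auto
    then show "col A j = col (X * Y) j" using y(2)[OF j] X Y j by (subst col_mult2) auto
  qed (use A X Y in auto)
  with X Y show ?thesis by blast
qed

section \<open>Unitary diagonalization of Hermitian matrices\<close>

lemma mat_adjoint_four_block_mat:
  fixes A :: "'a :: conjugatable_field mat"
  assumes "A \<in> carrier_mat n1 m1" "B \<in> carrier_mat n1 m2" "C \<in> carrier_mat n2 m1" "D \<in> carrier_mat n2 m2"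
  shows "mat_adjoint (four_block_mat A B C D) =
    four_block_mat (mat_adjoint A) (mat_adjoint C) (mat_adjoint B) (mat_adjoint D)"
  by (rule eq_matI) (use assms in auto)

text \<open>Complete \<open>v\<close> to a basis, orthogonalize and normalize. Gram-Schmidt keeps
  the head of the list, so the first column changes only by the normalizing factor
  \<open>c\<close>.\<close>

lemma exists_unitary_first_col:
  fixes v :: "complex vec"
  assumes v: "v \<in> carrier_vec n" and v0: "v \<noteq> 0\<^sub>v n" and n: "0 < n"
  shows "\<exists>W c. W \<in> carrier_mat n n \<and> mat_adjoint W * W = 1\<^sub>m n \<and> col W 0 = c \<cdot>\<^sub>v v"
proof -
  interpret cof_vec_space n "TYPE(complex)" .
  define b where "b = basis_completion v"
  define ws where "ws = gram_schmidt n b"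
  from basis_completion[OF v v0, folded b_def]
  have dist_b: "distinct b" and indep: "\<not> lin_dep (set b)" and b: "set b \<subseteq> carrier_vec n"
    and hdb: "hd b = v" and len_b: "length b = n" by auto
  from hdb len_b n obtain vs where bv: "b = v # vs" by (cases b) auto
  from gram_schmidt_result[OF b dist_b indep refl, folded ws_def]
  have ws: "set ws \<subseteq> carrier_vec n" "corthogonal ws" "length ws = n"
    by (auto simp: len_b)
  from gram_schmidt_hd[OF v, of vs, folded bv] have "hd ws = v" unfolding ws_def .
  then have ws0: "ws ! 0 = v" using ws n by (metis hd_conv_nth list.size(3) not_less0)
  have wsi: "ws ! i \<in> carrier_vec n" if "i < n" for i using ws that by auto
  \<comment> \<open>The reciprocal of the norm of \<open>ws ! i\<close>; the inner product of a
    vector with itself is real, so \<open>Re\<close> loses nothing.\<close>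
  define s where "s i = complex_of_real (1 / sqrt (Re (ws ! i \<bullet>c ws ! i)))" for i
  define W where "W = mat_of_cols n (map (\<lambda>i. s i \<cdot>\<^sub>v ws ! i) [0..<n])"
  have W: "W \<in> carrier_mat n n" by (rule carrier_matI) (auto simp: W_def)
  have colW: "col W i = s i \<cdot>\<^sub>v ws ! i" if "i < n" for i
    unfolding W_def using that wsi by (subst col_mat_of_cols) auto
  have "mat_adjoint W * W = 1\<^sub>m n"
  proof (rule eq_matI)
    fix i j assume "i < dim_row (1\<^sub>m n)" "j < dim_col (1\<^sub>m n)"
    then have i: "i < n" and j: "j < n" by auto
    have "(mat_adjoint W * W) $$ (i,j) = conjugate (col W i) \<bullet> col W j"
      using W i j by auto
    also have "\<dots> = s i * (s j * (ws ! j \<bullet>c ws ! i))"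
      unfolding conjugate_vec_sprod_comm[OF wsi[OF j] wsi[OF i]]
      using i j wsi[OF i] wsi[OF j] by (simp add: colW conjugate_smult_vec s_def)
    also have "\<dots> = 1\<^sub>m n $$ (i,j)"
    proof (cases "i = j")
      case True
      have "ws ! i \<bullet>c ws ! i > 0"
        using corthogonalD[OF ws(2), of i i] i ws wsi conjugate_square_ge_0_vec[of "ws ! i"]
        by (simp add: less_le)
      moreover define r where "r = Re (ws ! i \<bullet>c ws ! i)"
      ultimately have r: "r > 0" "ws ! i \<bullet>c ws ! i = complex_of_real r"
        by (auto simp: less_complex_def complex_eq_iff)
      have "s i * (s i * (ws ! i \<bullet>c ws ! i)) = complex_of_real (1 / sqrt r * (1 / sqrt r * r))"
        unfolding s_def r(2) Re_complex_of_real of_real_mult by (rule refl)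
      also have "1 / sqrt r * (1 / sqrt r * r) = 1" using r(1) by (simp add: field_simps)
      finally show ?thesis using True i by simp
    next
      case False
      then show ?thesis using corthogonalD[OF ws(2), of j i] i j ws by simp
    qed
    finally show "(mat_adjoint W * W) $$ (i,j) = 1\<^sub>m n $$ (i,j)" .
  qed (use W in auto)
  then show ?thesis using W colW[OF n] ws0 by auto
qed

text \<open>Induction by deflation: a unitary matrix whose first column is an eigenvector splits off
  a block of size 1, and the induction hypothesis diagonalizes the remaining Hermitian
  block.\<close>

lemma hermitian_unitary_diagonalization:
  fixes H :: "complex mat"
  assumes "H \<in> carrier_mat n n" "mat_adjoint H = H"
  shows "\<exists>U \<in> carrier_mat n n. mat_adjoint U * U = 1\<^sub>m n \<and> diagonal_mat (mat_adjoint U * H * U)"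
  using assms
proof (induction n arbitrary: H)
  case 0
  then show ?case by (intro bexI[of _ "1\<^sub>m 0"]) (auto simp: diagonal_mat_def)
next
  case (Suc n H)
  let ?N = "Suc n"
  note H = Suc.prems(1)
  obtain e where "eigenvalue H e" using spectrum_non_empty[OF H] by (auto simp: spectrum_def)
  then obtain v where v: "v \<in> carrier_vec ?N" "v \<noteq> 0\<^sub>v ?N" "H *\<^sub>v v = e \<cdot>\<^sub>v v"
    using H by (auto simp: eigenvalue_def eigenvector_def)
  obtain W c where W: "W \<in> carrier_mat ?N ?N" and WW: "mat_adjoint W * W = 1\<^sub>m ?N"
    and W0: "col W 0 = c \<cdot>\<^sub>v v"
    using exists_unitary_first_col[OF v(1,2)] by auto
  define A where "A = mat_adjoint W * H * W"
  have A: "A \<in> carrier_mat ?N ?N" unfolding A_def using W H by auto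
  have A_eq: "A = mat_adjoint W * (H * W)"
    unfolding A_def by (rule assoc_mult_mat) (use W H in auto)
  have "mat_adjoint A = mat_adjoint W * H * W"
    unfolding A_eq
    by (subst mat_adjoint_mult[of _ ?N ?N _ ?N], use W H in simp, use W H in simp,
        subst mat_adjoint_mult[of _ ?N ?N _ ?N]) (use W H Suc.prems in auto)
  then have Aherm: "mat_adjoint A = A" by (simp add: A_def)
  \<comment> \<open>Hence the first column of \<open>A\<close> is \<open>e\<close> times the first
    column of W^* W, which is the identity.\<close>
  have HW0: "col (H * W) 0 = e \<cdot>\<^sub>v col W 0"
    using H W v(1) by (subst col_mult2[OF H W]) (auto simp: W0 mult_mat_vec v(3) smult_smult_assoc mult.commute)
  have A0: "A $$ (i,0) = (if i = 0 then e else 0)" if i: "i < ?N" for i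
  proof -
    have "A $$ (i,0) = row (mat_adjoint W) i \<bullet> col (H * W) 0"
      unfolding A_eq using i W H by auto
    also have "\<dots> = e * (row (mat_adjoint W) i \<bullet> col W 0)"
      unfolding HW0 using W i col_dim[of W 0] by (subst scalar_prod_smult_distrib[of _ ?N]) auto
    also have "row (mat_adjoint W) i \<bullet> col W 0 = (mat_adjoint W * W) $$ (i,0)"
      using W i by auto
    finally show ?thesis using i by (simp add: WW)
  qed
  \<comment> \<open>Hermitian symmetry carries the zeros of the first column over to the first
    row.\<close>
  have A0': "A $$ (0,j) = (if j = 0 then e else 0)" if j: "j < ?N" for j
  proof (cases "j = 0")
    case False
    have "A $$ (0,j) = conjugate (A $$ (j,0))"
      using index_mat_adjoint[of 0 A j] Aherm A j by simp
    then show ?thesis using A0[OF j] False by simp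
  qed (use A0[OF j] in simp)
  define E where "E = mat 1 1 (\<lambda>_. e)"
  define D where "D = mat n n (\<lambda>(i,j). A $$ (Suc i, Suc j))"
  have E: "E \<in> carrier_mat 1 1" by (simp add: E_def)
  have D: "D \<in> carrier_mat n n" by (simp add: D_def)
  have A_block: "A = four_block_mat E (0\<^sub>m 1 n) (0\<^sub>m n 1) D"
    by (rule eq_matI) (use A in \<open>auto simp: E_def D_def A0 A0'\<close>)
  have "mat_adjoint D = D"
  proof (rule eq_matI)
    fix i j assume "i < dim_row D" "j < dim_col D"
    then show "mat_adjoint D $$ (i,j) = D $$ (i,j)"
      using index_mat_adjoint[of "Suc i" A "Suc j"] Aherm A by (simp add: D_def)
  qed (use D in auto)
  then obtain V where V: "V \<in> carrier_mat n n" "mat_adjoint V * V = 1\<^sub>m n"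
    "diagonal_mat (mat_adjoint V * D * V)"
    using Suc.IH[OF D] by blast
  \<comment> \<open>Extending \<open>V\<close> by a block 1 leaves the split-off eigenvalue alone;
    \<open>W * V'\<close> is the diagonalizing unitary matrix.\<close>
  define V' where "V' = four_block_mat (1\<^sub>m 1) (0\<^sub>m 1 n) (0\<^sub>m n 1) V"
  have V': "V' \<in> carrier_mat ?N ?N" using V unfolding V'_def by auto
  have adjV': "mat_adjoint V' = four_block_mat (1\<^sub>m 1) (0\<^sub>m 1 n) (0\<^sub>m n 1) (mat_adjoint V)"
    unfolding V'_def
    by (subst mat_adjoint_four_block_mat[of _ 1 1 _ n _ n]) (use V in simp_all)
  have one_block: "four_block_mat (1\<^sub>m 1) (0\<^sub>m 1 n) (0\<^sub>m n 1) (1\<^sub>m n) = (1\<^sub>m ?N :: complex mat)"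
    by (rule eq_matI) auto
  have VV: "mat_adjoint V' * V' = 1\<^sub>m ?N"
    unfolding adjV' unfolding V'_def
    by (subst mult_four_block_mat[of _ 1 1 _ n _ n _ _ 1 _ n]) (use V one_block in auto)
  have "mat_adjoint V' * A = four_block_mat E (0\<^sub>m 1 n) (0\<^sub>m n 1) (mat_adjoint V * D)"
    unfolding adjV' A_block
    by (subst mult_four_block_mat[of _ 1 1 _ n _ n _ _ 1 _ n]) (use V E D in auto)
  then have VAV: "mat_adjoint V' * A * V' = four_block_mat E (0\<^sub>m 1 n) (0\<^sub>m n 1) (mat_adjoint V * D * V)"
    unfolding V'_def
    by (simp, subst mult_four_block_mat[of _ 1 1 _ n _ n _ _ 1 _ n]) (use V E D in auto)
  have "diagonal_mat (four_block_mat E (0\<^sub>m 1 n) (0\<^sub>m n 1) F)"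
    if F: "F \<in> carrier_mat n n" "diagonal_mat F" for F
    unfolding diagonal_mat_def
  proof (intro allI impI)
    fix i j
    assume "i < dim_row (four_block_mat E (0\<^sub>m 1 n) (0\<^sub>m n 1) F)"
      "j < dim_col (four_block_mat E (0\<^sub>m 1 n) (0\<^sub>m n 1) F)" "i \<noteq> j"
    then show "four_block_mat E (0\<^sub>m 1 n) (0\<^sub>m n 1) F $$ (i,j) = 0"
      using F E by (cases i; cases j) (auto simp: diagonal_mat_def)
  qed
  from this[OF mult_carrier_mat[OF mult_carrier_mat[OF mat_adjoint_carrier[THEN iffD2, OF V(1)] D] V(1)] V(3)]
  have "diagonal_mat (mat_adjoint V' * A * V')"
    unfolding VAV .
  moreover have adjU: "mat_adjoint (W * V') = mat_adjoint V' * mat_adjoint W"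
    by (rule mat_adjoint_mult[OF W V'])
  moreover have "mat_adjoint (W * V') * (W * V') = 1\<^sub>m ?N"
  proof -
    have "mat_adjoint V' * mat_adjoint W * (W * V') = mat_adjoint V' * (mat_adjoint W * W) * V'"
      using W V' by (simp add: assoc_mult_mat[of _ ?N ?N _ ?N _ ?N])
    then show ?thesis unfolding adjU WW using V' VV by simp
  qed
  moreover have "mat_adjoint (W * V') * H * (W * V') = mat_adjoint V' * A * V'"
    unfolding adjU A_def using W V' H by (simp add: assoc_mult_mat[of _ ?N ?N _ ?N _ ?N])
  ultimately show ?case using W V' by (intro bexI[of _ "W * V'"]) auto
qed

text \<open>Take for \<open>u\<close> the columns of the diagonalizing matrix and for
  \<open>t\<close> its diagonal. This interface turns later arguments into sums over the coordinates
  \<open>x \<bullet>c u i\<close>. Eigenvalues may repeat in \<open>t\<close>.\<close>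

lemma hermitian_spectral:
  fixes H :: "complex mat"
  assumes H: "H \<in> carrier_mat n n" and herm: "mat_adjoint H = H"
  obtains u :: "nat \<Rightarrow> complex vec" and t :: "nat \<Rightarrow> real"
  where "\<And>i. i < n \<Longrightarrow> u i \<in> carrier_vec n"
    and "\<And>i x. i < n \<Longrightarrow> x \<in> carrier_vec n \<Longrightarrow> (H *\<^sub>v x) \<bullet>c u i = t i * (x \<bullet>c u i)"
    and "\<And>x y. x \<in> carrier_vec n \<Longrightarrow> y \<in> carrier_vec n \<Longrightarrow>
           x \<bullet>c y = (\<Sum>i<n. (x \<bullet>c u i) * cnj (y \<bullet>c u i))"
    and "\<And>a. eigenvalue H a \<longleftrightarrow> (\<exists>i<n. a = complex_of_real (t i))"
proof -
  obtain U where U: "U \<in> carrier_mat n n" and UU: "mat_adjoint U * U = 1\<^sub>m n"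
    and diag: "diagonal_mat (mat_adjoint U * H * U)"
    using hermitian_unitary_diagonalization[OF H herm] by blast
  let ?V = "mat_adjoint U"
  have V: "?V \<in> carrier_mat n n" using U by simp
  have UV: "U * ?V = 1\<^sub>m n" using mat_mult_left_right_inverse[OF V U UU] .
  define D where "D = ?V * H * U"
  have D: "D \<in> carrier_mat n n" unfolding D_def by (rule mult_carrier_mat[OF mult_carrier_mat[OF V H] U])
  have D_eq: "D = ?V * (H * U)" using U V H by (simp add: D_def assoc_mult_mat[of _ n n _ n _ n])
  have Dherm: "mat_adjoint D = D"
    unfolding D_eq using U H herm
    by (simp add: mat_adjoint_mult[of _ n n _ n] assoc_mult_mat[of _ n n _ n _ n])
  \<comment> \<open>In the coordinates given by \<open>?V\<close>, the matrix \<open>H\<close> acts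
    as the diagonal matrix \<open>D\<close>.\<close>
  have DV: "D * ?V = ?V * H"
  proof -
    have "D * ?V = ?V * H * (U * ?V)"
      using U V H by (simp add: D_def assoc_mult_mat[of _ n n _ n _ n])
    then show ?thesis using UV U V H by simp
  qed
  define u where "u = col U"
  define t where "t i = Re (D $$ (i,i))" for i
  have u: "u i \<in> carrier_vec n" for i
    using U col_dim[of U i] by (auto simp: u_def)
  have Dt: "D $$ (i,j) = (if i = j then complex_of_real (t i) else 0)" if "i < n" "j < n" for i j
  proof (cases "i = j")
    case True
    have "cnj (D $$ (i,i)) = D $$ (i,i)"
      using index_mat_adjoint[of i D i] Dherm D that by simp
    then have "D $$ (i,i) = complex_of_real (t i)"
      unfolding t_def by (simp add: complex_eq_iff)
    then show ?thesis using True by simp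
  next
    case False
    then show ?thesis using diag that D unfolding D_def[symmetric] diagonal_mat_def by auto
  qed
  have V_index: "(?V *\<^sub>v x) $ i = x \<bullet>c u i" if "i < n" "x \<in> carrier_vec n" for i x
    using that U conjugate_vec_sprod_comm[OF that(2) u[of i]] by (simp add: u_def)
  have "(H *\<^sub>v x) \<bullet>c u i = t i * (x \<bullet>c u i)" if i: "i < n" and x: "x \<in> carrier_vec n" for i x
  proof -
    have "(H *\<^sub>v x) \<bullet>c u i = (?V *\<^sub>v (H *\<^sub>v x)) $ i" using i x H by (simp add: V_index)
    also have "?V *\<^sub>v (H *\<^sub>v x) = (D * ?V) *\<^sub>v x" unfolding DV using V H x by simp
    also have "\<dots> = D *\<^sub>v (?V *\<^sub>v x)" using D V x by simp
    also have "\<dots> $ i = (\<Sum>j<n. D $$ (i,j) * (?V *\<^sub>v x) $ j)"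
      using i D V x by (auto simp: scalar_prod_def atLeast0LessThan intro!: sum.cong)
    also have "\<dots> = (\<Sum>j<n. if i = j then t i * (?V *\<^sub>v x) $ j else 0)"
      using i by (intro sum.cong) (auto simp: Dt)
    also have "\<dots> = t i * (x \<bullet>c u i)" using i x by (simp add: V_index)
    finally show ?thesis .
  qed
  moreover have "x \<bullet>c y = (\<Sum>i<n. (x \<bullet>c u i) * cnj (y \<bullet>c u i))"
    if x: "x \<in> carrier_vec n" and y: "y \<in> carrier_vec n" for x y
  proof -
    have "(?V *\<^sub>v x) \<bullet>c (?V *\<^sub>v y) = x \<bullet>c (U *\<^sub>v (?V *\<^sub>v y))"
      using mult_mat_vec_cscalar_prod[OF V x, of "?V *\<^sub>v y"] V y by simp
    also have "U *\<^sub>v (?V *\<^sub>v y) = (U * ?V) *\<^sub>v y" using U V y by simp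
    also have "\<dots> = y" using UV y by simp
    finally have "x \<bullet>c y = (?V *\<^sub>v x) \<bullet>c (?V *\<^sub>v y)" ..
    also have "\<dots> = (\<Sum>i<n. (?V *\<^sub>v x) $ i * cnj ((?V *\<^sub>v y) $ i))"
      using U by (simp add: scalar_prod_def atLeast0LessThan del: index_mult_mat_vec)
    also have "\<dots> = (\<Sum>i<n. (x \<bullet>c u i) * cnj (y \<bullet>c u i))"
      using x y by (intro sum.cong) (simp_all add: V_index del: index_mult_mat_vec)
    finally show ?thesis .
  qed
  moreover have "eigenvalue H a \<longleftrightarrow> (\<exists>i<n. a = complex_of_real (t i))" for a
  proof -
    \<comment> \<open>Similar matrices share their characteristic polynomial, and that of the
      diagonal matrix \<open>D\<close> shows its roots.\<close>
    have "similar_mat_wit D H ?V U"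
      by (rule similar_mat_witI[of _ _ n]) (use UU UV D_def D H U V in auto)
    then have "char_poly H = char_poly D"
      using char_poly_similar[of D H] unfolding similar_mat_def by metis
    also have "\<dots> = (\<Prod>a \<leftarrow> diag_mat D. [:- a, 1:])"
      by (rule char_poly_upper_triangular[OF D]) (use D Dt in auto)
    finally have "eigenvalue H a \<longleftrightarrow> a \<in> set (diag_mat D)"
      unfolding eigenvalue_root_char_poly[OF H] by (auto simp: poly_prod_list prod_list_zero_iff)
    then show ?thesis using D Dt by (auto simp: diag_mat_def)
  qed
  ultimately show ?thesis using that[of u t] u by blast
qed

section \<open>Quadratic forms and the count of negative eigenvalues\<close>

text \<open>For Hermitian \<open>H\<close> this is \<open>x\<^sup>*(aH\<^sup>2 + bH + c)x\<close>.\<close>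

definition quadratic_form :: "real \<Rightarrow> real \<Rightarrow> real \<Rightarrow> complex mat \<Rightarrow> complex vec \<Rightarrow> real" where
  "quadratic_form a b c H x =
     a * Re ((H *\<^sub>v x) \<bullet>c (H *\<^sub>v x)) + b * Re ((H *\<^sub>v x) \<bullet>c x) + c * Re (x \<bullet>c x)"

text \<open>In eigenvector coordinates \<open>H\<close> multiplies the \<open>i\<close>-th entry by
  \<open>t i\<close>, so by Parseval each of the three terms is a weighted sum of the same squared
  moduli.\<close>

lemma quadratic_form_spectral:
  assumes H: "H \<in> carrier_mat n n" and x: "x \<in> carrier_vec n"
    and act: "\<And>i x. i < n \<Longrightarrow> x \<in> carrier_vec n \<Longrightarrow> (H *\<^sub>v x) \<bullet>c u i = complex_of_real (t i) * (x \<bullet>c u i)"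
    and parseval: "\<And>x y. x \<in> carrier_vec n \<Longrightarrow> y \<in> carrier_vec n \<Longrightarrow>
           x \<bullet>c y = (\<Sum>i<n. (x \<bullet>c u i) * cnj (y \<bullet>c u i))"
  shows "quadratic_form a b c H x =
    (\<Sum>i<n. (a * (t i)\<^sup>2 + b * t i + c) * (cmod (x \<bullet>c u i))\<^sup>2)"
proof -
  have Hx: "H *\<^sub>v x \<in> carrier_vec n" using H x by simp
  have sq: "Re (z * cnj z) = (cmod z)\<^sup>2" for z by (simp add: complex_mult_cnj cmod_power2)
  have "Re ((H *\<^sub>v x) \<bullet>c (H *\<^sub>v x)) = (\<Sum>i<n. (t i)\<^sup>2 * (cmod (x \<bullet>c u i))\<^sup>2)"
    unfolding parseval[OF Hx Hx] Re_sum
    using x by (intro sum.cong) (simp_all add: act cmod_power2, simp add: power2_eq_square algebra_simps)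
  moreover have "Re ((H *\<^sub>v x) \<bullet>c x) = (\<Sum>i<n. t i * (cmod (x \<bullet>c u i))\<^sup>2)"
    unfolding parseval[OF Hx x] Re_sum
    using x by (intro sum.cong) (simp_all add: act cmod_power2, simp add: power2_eq_square algebra_simps)
  moreover have "Re (x \<bullet>c x) = (\<Sum>i<n. (cmod (x \<bullet>c u i))\<^sup>2)"
    unfolding parseval[OF x x] Re_sum sq by (rule refl)
  ultimately show ?thesis
    unfolding quadratic_form_def by (simp add: sum_distrib_left distrib_right sum.distrib mult.assoc)
qed

text \<open>The eigenvectors of \<open>K\<close> with \<open>q < 0\<close> span a space on which the form of \<open>K\<close> is negative definite.
  If its dimension exceeded the number of functionals in \<open>L\<close>, it would contain a nonzero common
  zero of \<open>L\<close>, where the form of \<open>K\<close> agrees with the nonnegative form of \<open>H\<close>.\<close>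

lemma card_negative_eigenvalues_le:
  fixes H K :: "complex mat" and a b c :: real
  defines "q \<equiv> \<lambda>t. a * t\<^sup>2 + b * t + c"
  assumes H: "H \<in> carrier_mat n n" "mat_adjoint H = H"
    and K: "K \<in> carrier_mat n n" "mat_adjoint K = K"
    and nonneg: "\<And>t. eigenvalue H (complex_of_real t) \<Longrightarrow> 0 \<le> q t"
    and L: "set L \<subseteq> carrier_vec n"
    and agree: "\<And>x. x \<in> carrier_vec n \<Longrightarrow> (\<forall>r \<in> set L. r \<bullet> x = 0) \<Longrightarrow>
       quadratic_form a b c H x = quadratic_form a b c K x"
  shows "card {t. eigenvalue K (complex_of_real t) \<and> q t < 0} \<le> length L"
proof -
  obtain u t where u: "\<And>i. i < n \<Longrightarrow> u i \<in> carrier_vec n"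
    and act: "\<And>i x. i < n \<Longrightarrow> x \<in> carrier_vec n \<Longrightarrow> (K *\<^sub>v x) \<bullet>c u i = complex_of_real (t i) * (x \<bullet>c u i)"
    and parseval: "\<And>x y. x \<in> carrier_vec n \<Longrightarrow> y \<in> carrier_vec n \<Longrightarrow>
           x \<bullet>c y = (\<Sum>i<n. (x \<bullet>c u i) * cnj (y \<bullet>c u i))"
    and ev: "\<And>a. eigenvalue K a \<longleftrightarrow> (\<exists>i<n. a = complex_of_real (t i))"
    by (rule hermitian_spectral[OF K]) (rule that)
  obtain v s where v: "\<And>i. i < n \<Longrightarrow> v i \<in> carrier_vec n"
    and actH: "\<And>i x. i < n \<Longrightarrow> x \<in> carrier_vec n \<Longrightarrow> (H *\<^sub>v x) \<bullet>c v i = complex_of_real (s i) * (x \<bullet>c v i)"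
    and parsevalH: "\<And>x y. x \<in> carrier_vec n \<Longrightarrow> y \<in> carrier_vec n \<Longrightarrow>
           x \<bullet>c y = (\<Sum>i<n. (x \<bullet>c v i) * cnj (y \<bullet>c v i))"
    and evH: "\<And>a. eigenvalue H a \<longleftrightarrow> (\<exists>i<n. a = complex_of_real (s i))"
    by (rule hermitian_spectral[OF H]) (rule that)
  \<comment> \<open>Indices count eigenvalues with multiplicity, so \<open>card I\<close> bounds the
    number of distinct ones.\<close>
  define I where "I = {i. i < n \<and> q (t i) < 0}"
  have "{t. eigenvalue K (complex_of_real t) \<and> q t < 0} = t ` I"
    by (auto simp: ev I_def)
  then have card_le: "card {t. eigenvalue K (complex_of_real t) \<and> q t < 0} \<le> card I"
    by (simp add: card_image_le I_def)
  have "card I \<le> length L"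
  proof (rule ccontr)
    assume big: "\<not> card I \<le> length L"
    \<comment> \<open>Orthogonality to \<open>u i\<close> for \<open>i\<close> in \<open>J\<close>
      confines \<open>x\<close> to the span of the eigenvectors with \<open>q < 0\<close>. The
      vectors are conjugated to turn \<bullet>c into the bilinear pairing.\<close>
    define J where "J = filter (\<lambda>i. \<not> q (t i) < 0) [0..<n]"
    have "length (filter (\<lambda>i. q (t i) < 0) [0..<n]) = card I"
      unfolding length_filter_conv_card I_def by (rule arg_cong[of _ _ card]) auto
    then have "card I + length J = n"
      using sum_length_filter_compl[of "\<lambda>i. q (t i) < 0" "[0..<n]"] by (simp add: J_def)
    then have "length (L @ map (\<lambda>i. conjugate (u i)) J) < n" using big by simp
    moreover have "set (L @ map (\<lambda>i. conjugate (u i)) J) \<subseteq> carrier_vec n"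
      using L u by (auto simp: J_def)
    ultimately obtain x where x: "x \<in> carrier_vec n" "x \<noteq> 0\<^sub>v n"
      and ann: "\<forall>r \<in> set (L @ map (\<lambda>i. conjugate (u i)) J). r \<bullet> x = 0"
      using exists_nonzero_annihilated by metis
    have "x \<bullet>c u i = 0" if "i < n" "\<not> q (t i) < 0" for i
    proof -
      have "conjugate (u i) \<bullet> x = 0" using ann that by (auto simp: J_def)
      then show ?thesis using conjugate_vec_sprod_comm[OF x(1) u[OF that(1)]] by simp
    qed
    then have terms: "q (t i) * (cmod (x \<bullet>c u i))\<^sup>2 \<le> 0"
      and strict: "x \<bullet>c u i \<noteq> 0 \<Longrightarrow> q (t i) * (cmod (x \<bullet>c u i))\<^sup>2 < 0" if "i < n" for i
      using that by (force simp: mult_le_0_iff mult_less_0_iff)+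
    have "x \<bullet>c x \<noteq> 0" using x by simp
    \<comment> \<open>Parseval gives a nonzero coordinate, which makes the inequality for the sum
      strict.\<close>
    then obtain i where i: "i < n" "x \<bullet>c u i \<noteq> 0"
      unfolding parseval[OF x(1) x(1)] by (metis (no_types, lifting) lessThan_iff mult_zero_left sum.neutral)
    have "quadratic_form a b c K x = (\<Sum>i<n. q (t i) * (cmod (x \<bullet>c u i))\<^sup>2)"
      unfolding q_def by (rule quadratic_form_spectral[OF K(1) x(1) act parseval])
    also have "\<dots> < (\<Sum>i<n. 0)"
      by (rule sum_strict_mono_ex1) (use terms strict i in auto)
    finally have "quadratic_form a b c K x < 0" by simp
    moreover have "quadratic_form a b c H x = (\<Sum>i<n. q (s i) * (cmod (x \<bullet>c v i))\<^sup>2)"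
      unfolding q_def by (rule quadratic_form_spectral[OF H(1) x(1) actH parsevalH])
    then have "0 \<le> quadratic_form a b c H x"
      using nonneg evH by (auto intro!: sum_nonneg mult_nonneg_nonneg)
    moreover have "quadratic_form a b c H x = quadratic_form a b c K x"
      using agree[OF x(1)] ann by auto
    ultimately show False by simp
  qed
  with card_le show ?thesis by simp
qed

section \<open>Gram matrices and singular values\<close>

lemma mat_adjoint_gram:
  fixes A :: "complex mat"
  assumes "A \<in> carrier_mat n m"
  shows "mat_adjoint (mat_adjoint A * A) = mat_adjoint A * A"
  using mat_adjoint_mult[of "mat_adjoint A" m n A m] assms by simp

lemma gram_mult_vec:
  fixes A :: "complex mat"
  assumes A: "A \<in> carrier_mat n m" and x: "x \<in> carrier_vec m"
  shows "(mat_adjoint A * A) *\<^sub>v x = mat_adjoint A *\<^sub>v (A *\<^sub>v x)"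
  by (rule assoc_mult_mat_vec[of _ m n _ m]) (use A x in simp_all)

lemma gram_cscalar_prod:
  fixes A :: "complex mat"
  assumes A: "A \<in> carrier_mat n m" and x: "x \<in> carrier_vec m"
  shows "((mat_adjoint A * A) *\<^sub>v x) \<bullet>c x = (A *\<^sub>v x) \<bullet>c (A *\<^sub>v x)"
  unfolding gram_mult_vec[OF A x]
  using mult_mat_vec_cscalar_prod[of "mat_adjoint A" m n "A *\<^sub>v x" x] A x by simp

text \<open>For an eigenvector \<open>v\<close>, t |v|^2 = |Av|^2, and |v|^2 is positive.\<close>

lemma eigenvalue_gram_nonneg:
  fixes A :: "complex mat"
  assumes A: "A \<in> carrier_mat n n" and ev: "eigenvalue (mat_adjoint A * A) (complex_of_real t)"
  shows "0 \<le> t"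
proof -
  obtain v where v: "v \<in> carrier_vec n" "v \<noteq> 0\<^sub>v n"
    and ev: "(mat_adjoint A * A) *\<^sub>v v = complex_of_real t \<cdot>\<^sub>v v"
    using ev A by (auto simp: eigenvalue_def eigenvector_def)
  have "complex_of_real t * (v \<bullet>c v) = (A *\<^sub>v v) \<bullet>c (A *\<^sub>v v)"
    unfolding gram_cscalar_prod[OF A v(1), symmetric] ev using v by simp
  moreover have "(A *\<^sub>v v) \<bullet>c (A *\<^sub>v v) \<ge> 0"
    by (rule conjugate_square_ge_0_vec)
  ultimately have "complex_of_real t * (v \<bullet>c v) \<ge> 0" by simp
  moreover have "v \<bullet>c v > 0" using v by simp
  ultimately show ?thesis
    by (auto simp: less_eq_complex_def less_complex_def zero_le_mult_iff)
qed

lemma eigenvalue_gram_iff: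
  assumes A: "A \<in> carrier_mat n n"
  shows "eigenvalue (mat_adjoint A * A) (complex_of_real t) \<longleftrightarrow> (\<exists>s \<in> singular_values A. t = s\<^sup>2)"
proof
  assume ev: "eigenvalue (mat_adjoint A * A) (complex_of_real t)"
  then have "0 \<le> t" by (rule eigenvalue_gram_nonneg[OF A])
  then have "t = (sqrt t)\<^sup>2" "0 \<le> sqrt t" by simp_all
  with ev show "\<exists>s \<in> singular_values A. t = s\<^sup>2"
    unfolding singular_values_def by (intro bexI[of _ "sqrt t"]) (auto simp del: of_real_power)
qed (auto simp: singular_values_def simp del: of_real_power)

text \<open>A complex matrix of positive size has an eigenvalue, and that of a Gram matrix is real,
  hence the square of a singular value. This gives meaning to the least and greatest singular value
  of \<open>A\<close>.\<close>

lemma singular_values_nonempty: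
  assumes A: "A \<in> carrier_mat n n" and n: "0 < n"
  shows "singular_values A \<noteq> {}"
proof -
  have G: "mat_adjoint A * A \<in> carrier_mat n n" using A by (simp add: mult_carrier_mat[of _ n n])
  obtain a where a: "eigenvalue (mat_adjoint A * A) a"
    using spectrum_non_empty[OF G n] by (auto simp: spectrum_def)
  obtain t :: "nat \<Rightarrow> real" where
    "\<And>a. eigenvalue (mat_adjoint A * A) a \<longleftrightarrow> (\<exists>i<n. a = complex_of_real (t i))"
    by (rule hermitian_spectral[OF G mat_adjoint_gram[OF A]]) (rule that)
  with a obtain i where "a = complex_of_real (t i)" by blast
  with a have "\<exists>s \<in> singular_values A. t i = s\<^sup>2"
    using eigenvalue_gram_iff[OF A] by simp
  then show ?thesis by blast
qed

text \<open>The eigenvalue count for Gram matrices carries over because squaring is injective on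
  nonnegative reals.\<close>

lemma card_singular_values_negative_le:
  fixes A C :: "complex mat" and a b c :: real
  defines "q \<equiv> \<lambda>t. a * t\<^sup>2 + b * t + c"
  assumes A: "A \<in> carrier_mat n n" and C: "C \<in> carrier_mat n n"
    and nonneg: "\<And>s. s \<in> singular_values A \<Longrightarrow> 0 \<le> q (s\<^sup>2)"
    and L: "set L \<subseteq> carrier_vec n"
    and agree: "\<And>x. x \<in> carrier_vec n \<Longrightarrow> (\<forall>r \<in> set L. r \<bullet> x = 0) \<Longrightarrow>
       quadratic_form a b c (mat_adjoint A * A) x = quadratic_form a b c (mat_adjoint C * C) x"
  shows "card {s \<in> singular_values C. q (s\<^sup>2) < 0} \<le> length L"
proof -
  have "card {t. eigenvalue (mat_adjoint C * C) (complex_of_real t) \<and> q t < 0} \<le> length L"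
    unfolding q_def
  proof (rule card_negative_eigenvalues_le[OF _ mat_adjoint_gram[OF A] _ mat_adjoint_gram[OF C] _ L agree])
    fix t assume "eigenvalue (mat_adjoint A * A) (complex_of_real t)"
    then show "0 \<le> a * t\<^sup>2 + b * t + c"
      using nonneg unfolding eigenvalue_gram_iff[OF A] q_def by blast
  qed (use A C in \<open>simp_all add: mult_carrier_mat[of _ n n]\<close>)
  also have "{t. eigenvalue (mat_adjoint C * C) (complex_of_real t) \<and> q t < 0} =
      (\<lambda>s. s\<^sup>2) ` {s \<in> singular_values C. q (s\<^sup>2) < 0}"
    unfolding eigenvalue_gram_iff[OF C] by blast
  also have "card \<dots> = card {s \<in> singular_values C. q (s\<^sup>2) < 0}"
    by (rule card_image) (auto simp: inj_on_def singular_values_def)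
  finally show ?thesis .
qed

section \<open>Counting points between consecutive elements of a finite set\<close>

text \<open>\<open>S\<close> cuts its complement into \<open>card S - 1\<close> gaps and two outer
  rays. The rays contribute at most \<open>r\<close> each, which together is worth one more
  gap.\<close>

lemma card_le_via_gaps:
  fixes S T :: "'a :: linorder set"
  assumes S: "finite S" "S \<noteq> {}" and T: "finite T" and disj: "S \<inter> T = {}"
    and below: "card {t \<in> T. t < Min S} \<le> r"
    and above: "card {t \<in> T. Max S < t} \<le> r"
    and gap: "\<And>a b. a \<in> S \<Longrightarrow> b \<in> S \<Longrightarrow> a < b \<Longrightarrow> (\<And>s. s \<in> S \<Longrightarrow> s \<le> a \<or> b \<le> s) \<Longrightarrow>
       card {t \<in> T. a < t \<and> t < b} \<le> 2 * r"
  shows "card T \<le> 2 * r * card S"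
proof -
  \<comment> \<open>The next element of \<open>S\<close> after \<open>a\<close>, meaningful for
    every element except the maximum; \<open>G a\<close> is the part of \<open>T\<close> in the gap
    starting at \<open>a\<close>.\<close>
  define succ where "succ a = Min {s \<in> S. a < s}" for a
  define G where "G a = {t \<in> T. a < t \<and> t < succ a}" for a
  have succ: "succ a \<in> S" "a < succ a" "\<And>s. s \<in> S \<Longrightarrow> s \<le> a \<or> succ a \<le> s"
    if a: "a \<in> S - {Max S}" for a
  proof -
    have "a < Max S" using a S by (simp add: order.not_eq_order_implies_strict)
    then have ne: "{s \<in> S. a < s} \<noteq> {}" using S Max_in by blast
    have "succ a \<in> {s \<in> S. a < s}"
      unfolding succ_def by (rule Min_in) (use S ne in auto)
    then show "succ a \<in> S" "a < succ a" by auto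
    show "s \<le> a \<or> succ a \<le> s" if "s \<in> S" for s
      unfolding succ_def using that S by (cases "a < s") auto
  qed
  have "T \<subseteq> {t \<in> T. t < Min S} \<union> {t \<in> T. Max S < t} \<union> (\<Union>a \<in> S - {Max S}. G a)"
  proof
    fix t assume t: "t \<in> T"
    show "t \<in> {t \<in> T. t < Min S} \<union> {t \<in> T. Max S < t} \<union> (\<Union>a \<in> S - {Max S}. G a)"
    proof (cases "t < Min S \<or> Max S < t")
      case False
      have "t \<noteq> Min S" "t \<noteq> Max S" using t disj Min_in[OF S] Max_in[OF S] by auto
      with False have "Min S < t" "t < Max S" by auto
      \<comment> \<open>The gap containing \<open>t\<close> starts at the largest element of
        \<open>S\<close> below \<open>t\<close>; were \<open>succ a\<close> also below
        \<open>t\<close>, it would contradict that choice.\<close>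
      define a where "a = Max {s \<in> S. s < t}"
      have ne: "{s \<in> S. s < t} \<noteq> {}" using Min_in[OF S] \<open>Min S < t\<close> by blast
      have "a \<in> {s \<in> S. s < t}"
        unfolding a_def by (rule Max_in) (use S ne in auto)
      then have a: "a \<in> S - {Max S}" "a < t" using \<open>t < Max S\<close> by auto
      have "\<not> succ a < t"
      proof
        assume "succ a < t"
        then have "succ a \<le> Max {s \<in> S. s < t}" using S succ(1)[OF a(1)] by (intro Max_ge) auto
        then show False using succ(2)[OF a(1)] by (simp add: a_def)
      qed
      moreover have "succ a \<noteq> t" using succ(1)[OF a(1)] t disj by auto
      ultimately have "t \<in> G a" using a t by (auto simp: G_def)
      then show ?thesis using a by blast
    qed (use t in auto)
  qed
  then have "card T \<le> card ({t \<in> T. t < Min S} \<union> {t \<in> T. Max S < t} \<union> (\<Union>a \<in> S - {Max S}. G a))"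
    by (rule card_mono[rotated]) (use S T in \<open>auto simp: G_def\<close>)
  also have "\<dots> \<le> card {t \<in> T. t < Min S} + card {t \<in> T. Max S < t} + card (\<Union>a \<in> S - {Max S}. G a)"
    by (meson add_mono card_Un_le order_refl order_trans)
  also have "card (\<Union>a \<in> S - {Max S}. G a) \<le> (\<Sum>a \<in> S - {Max S}. card (G a))"
    by (rule card_UN_le) (use S in simp)
  also have "\<dots> \<le> (\<Sum>a \<in> S - {Max S}. 2 * r)"
    by (rule sum_mono) (use gap succ in \<open>auto simp: G_def\<close>)
  also have "\<dots> = 2 * r * (card S - 1)" using S by simp
  finally have "card T \<le> r + r + 2 * r * (card S - 1)" using below above by linarith
  also have "\<dots> = 2 * r * card S" using S by (cases "card S") auto
  finally show ?thesis .
qed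

section \<open>Comparison of the singular values of \<open>A\<close> and \<open>C\<close>\<close>

theorem corollary2p6:
  fixes n :: nat and A B C :: "complex mat"
  assumes "n > 0"
    and "A \<in> carrier_mat n n"
    and "B \<in> carrier_mat n n"
    and "C = A + B"
  shows "int (card (singular_values C))
           \<le> (2 * int (vec_space.rank n B) + 1) * int (card (singular_values A))
              - int (card (singular_values A - singular_values C))"
proof -
  note A = assms(2) and B = assms(3)
  have C: "C \<in> carrier_mat n n" using A B assms(4) by simp
  define r where "r = vec_space.rank n B"
  obtain X Y where X: "X \<in> carrier_mat n r" and Y: "Y \<in> carrier_mat r n" and B_eq: "B = X * Y"
    using vec_space.rank_factorization[OF B] unfolding r_def by blast
  \<comment> \<open>As B^* C = Y^* X^* C, the rows of \<open>XC\<close> are \<open>r\<close>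
    functionals whose common zeros are killed by B^* C.\<close>
  define XC where "XC = mat_adjoint X * C"
  have XC: "XC \<in> carrier_mat r n" using X C by (simp add: XC_def mult_carrier_mat[of _ r n])
  have rows_Y: "set (rows Y) \<subseteq> carrier_vec n" "length (rows Y) = r"
    and rows_XC: "set (rows XC) \<subseteq> carrier_vec n" "length (rows XC) = r"
    using Y XC by (auto simp: rows_def)
  have rows_0: "M *\<^sub>v x = 0\<^sub>v r"
    if "M \<in> carrier_mat r n" "\<forall>v \<in> set (rows M). v \<bullet> x = 0" for M :: "complex mat" and x
    by (rule eq_vecI) (use that in \<open>auto simp: rows_def\<close>)
  have CA: "C *\<^sub>v x = A *\<^sub>v x"
    if x: "x \<in> carrier_vec n" and 0: "\<forall>v \<in> set (rows Y). v \<bullet> x = 0" for x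
  proof -
    have "B *\<^sub>v x = X *\<^sub>v (Y *\<^sub>v x)" unfolding B_eq by (rule assoc_mult_mat_vec[OF X Y x])
    then have "B *\<^sub>v x = 0\<^sub>v n" using rows_0[OF Y 0] X by auto
    moreover have "C *\<^sub>v x = A *\<^sub>v x + B *\<^sub>v x"
      unfolding assms(4) by (rule add_mult_distrib_mat_vec[OF A B x])
    ultimately show ?thesis using A x by simp
  qed
  \<comment> \<open>C^* C x = A^* C x + B^* C x: the rows of \<open>XC\<close> remove the last term,
    and those of \<open>Y\<close> turn \<open>C\<close> into \<open>A\<close> in the first.\<close>
  have gram_CA: "(mat_adjoint C * C) *\<^sub>v x = (mat_adjoint A * A) *\<^sub>v x"
    if x: "x \<in> carrier_vec n" and 0: "\<forall>v \<in> set (rows Y @ rows XC). v \<bullet> x = 0" for x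
  proof -
    have Cx: "C *\<^sub>v x \<in> carrier_vec n" using C x by simp
    have "mat_adjoint B *\<^sub>v (C *\<^sub>v x) = mat_adjoint Y *\<^sub>v (mat_adjoint X *\<^sub>v (C *\<^sub>v x))"
      unfolding B_eq mat_adjoint_mult[OF X Y]
      by (rule assoc_mult_mat_vec[of _ n r _ n]) (use X Y Cx in simp_all)
    also have "mat_adjoint X *\<^sub>v (C *\<^sub>v x) = XC *\<^sub>v x"
      unfolding XC_def by (rule assoc_mult_mat_vec[of _ r n _ n, symmetric]) (use X C x in simp_all)
    also have "\<dots> = 0\<^sub>v r" by (rule rows_0[OF XC]) (use 0 in auto)
    finally have "mat_adjoint B *\<^sub>v (C *\<^sub>v x) = 0\<^sub>v n" using Y by auto
    moreover have "mat_adjoint C *\<^sub>v (C *\<^sub>v x) =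
        mat_adjoint A *\<^sub>v (C *\<^sub>v x) + mat_adjoint B *\<^sub>v (C *\<^sub>v x)"
      unfolding assms(4) mat_adjoint_add[OF A B]
      by (rule add_mult_distrib_mat_vec[of _ n n]) (use A B Cx assms(4) in simp_all)
    moreover have "C *\<^sub>v x = A *\<^sub>v x" using CA[OF x] 0 by simp
    ultimately show ?thesis using A C x by (simp add: gram_mult_vec[of _ n n])
  qed
  let ?SA = "singular_values A" and ?SC = "singular_values C"
  have fin: "finite ?SA" "finite ?SC" using finite_singular_values A C by auto
  have pos: "0 \<le> s" if "s \<in> ?SA \<union> ?SC" for s using that by (auto simp: singular_values_def)
  have ne: "?SA \<noteq> {}" by (rule singular_values_nonempty[OF A assms(1)])
  \<comment> \<open>With leading coefficient 0 the form depends only on |Ax|^2 and |x|^2, so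
    \<open>A\<close> and \<open>C\<close> need to agree only on the zeros of the \<open>r\<close>
    rows of \<open>Y\<close>.\<close>
  have outer: "card {s \<in> ?SC. b * s\<^sup>2 + c < 0} \<le> r"
    if "\<And>s. s \<in> ?SA \<Longrightarrow> 0 \<le> b * s\<^sup>2 + c" for b c
  proof -
    have "card {s \<in> ?SC. 0 * (s\<^sup>2)\<^sup>2 + b * s\<^sup>2 + c < 0} \<le> length (rows Y)"
    proof (rule card_singular_values_negative_le[OF A C _ rows_Y(1)])
      fix x :: "complex vec" assume x: "x \<in> carrier_vec n" and 0: "\<forall>v \<in> set (rows Y). v \<bullet> x = 0"
      show "quadratic_form 0 b c (mat_adjoint A * A) x = quadratic_form 0 b c (mat_adjoint C * C) x"
        unfolding quadratic_form_def gram_cscalar_prod[OF A x] gram_cscalar_prod[OF C x] CA[OF x 0]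
        by simp
    qed (use that in simp)
    then show ?thesis using rows_Y(2) by simp
  qed
  \<comment> \<open>The square term involves |A^* A x|^2, so the Gram matrices themselves must
    agree, which costs \<open>2 * r\<close> functionals.\<close>
  have inner: "card {s \<in> ?SC. (s\<^sup>2 - a\<^sup>2) * (s\<^sup>2 - b\<^sup>2) < 0} \<le> 2 * r"
    if "\<And>s. s \<in> ?SA \<Longrightarrow> 0 \<le> (s\<^sup>2 - a\<^sup>2) * (s\<^sup>2 - b\<^sup>2)" for a b
  proof -
    have q: "(t - a\<^sup>2) * (t - b\<^sup>2) = 1 * t\<^sup>2 + (- (a\<^sup>2 + b\<^sup>2)) * t + a\<^sup>2 * b\<^sup>2" for t
      by (simp add: power2_eq_square algebra_simps)
    have "card {s \<in> ?SC. 1 * (s\<^sup>2)\<^sup>2 + (- (a\<^sup>2 + b\<^sup>2)) * s\<^sup>2 + a\<^sup>2 * b\<^sup>2 < 0} \<le> length (rows Y @ rows XC)"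
    proof (rule card_singular_values_negative_le[OF A C])
      fix x :: "complex vec"
      assume x: "x \<in> carrier_vec n" and 0: "\<forall>v \<in> set (rows Y @ rows XC). v \<bullet> x = 0"
      show "quadratic_form 1 (- (a\<^sup>2 + b\<^sup>2)) (a\<^sup>2 * b\<^sup>2) (mat_adjoint A * A) x =
        quadratic_form 1 (- (a\<^sup>2 + b\<^sup>2)) (a\<^sup>2 * b\<^sup>2) (mat_adjoint C * C) x"
        unfolding quadratic_form_def gram_CA[OF x 0] by (rule refl)
    qed (use that[unfolded q] rows_Y rows_XC in auto)
    then show ?thesis using rows_Y(2) rows_XC(2) by (simp add: q)
  qed
  have "card (?SC - ?SA) \<le> 2 * r * card ?SA"
  proof (rule card_le_via_gaps[OF fin(1) ne])
    \<comment> \<open>The polynomial t - m^2, with m the least singular value of \<open>A\<close>,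
      is negative exactly at the squares of smaller singular values of \<open>C\<close>.\<close>
    have "card {s \<in> ?SC. 1 * s\<^sup>2 + - (Min ?SA)\<^sup>2 < 0} \<le> r"
      by (rule outer) (use fin ne pos in \<open>auto intro!: power_mono\<close>)
    then show "card {t \<in> ?SC - ?SA. t < Min ?SA} \<le> r"
      by (rule order_trans[rotated], intro card_mono)
        (use fin pos in \<open>auto intro!: power_strict_mono\<close>)
    \<comment> \<open>Likewise M^2 - t, with M the greatest singular value of \<open>A\<close>,
      singles out the larger ones.\<close>
    have "card {s \<in> ?SC. -1 * s\<^sup>2 + (Max ?SA)\<^sup>2 < 0} \<le> r"
      by (rule outer) (use fin ne pos in \<open>auto intro!: power_mono\<close>)
    then show "card {t \<in> ?SC - ?SA. Max ?SA < t} \<le> r"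
      by (rule order_trans[rotated], intro card_mono)
        (use fin ne pos Max_in in \<open>auto intro!: power_strict_mono\<close>)
    fix a b assume ab: "a \<in> ?SA" "b \<in> ?SA" "a < b" and none: "\<And>s. s \<in> ?SA \<Longrightarrow> s \<le> a \<or> b \<le> s"
    \<comment> \<open>The product is negative exactly when s^2 lies strictly between a^2 and b^2,
      which no singular value of \<open>A\<close> does since \<open>a\<close> and \<open>b\<close>
      are consecutive.\<close>
    have "card {s \<in> ?SC. (s\<^sup>2 - a\<^sup>2) * (s\<^sup>2 - b\<^sup>2) < 0} \<le> 2 * r"
    proof (rule inner)
      fix s assume s: "s \<in> ?SA"
      then consider "s\<^sup>2 \<le> a\<^sup>2" | "b\<^sup>2 \<le> s\<^sup>2"
        using none[OF s] ab pos by (meson UnI1 power_mono)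
      moreover have "a\<^sup>2 \<le> b\<^sup>2" using ab pos by (intro power_mono) auto
      ultimately show "0 \<le> (s\<^sup>2 - a\<^sup>2) * (s\<^sup>2 - b\<^sup>2)"
        by cases (auto simp: zero_le_mult_iff)
    qed
    moreover have "a\<^sup>2 < t\<^sup>2" "t\<^sup>2 < b\<^sup>2" if "a < t" "t < b" "t \<in> ?SC" for t
      using that ab pos by (auto intro!: power_strict_mono)
    then have "{t \<in> ?SC - ?SA. a < t \<and> t < b} \<subseteq> {s \<in> ?SC. (s\<^sup>2 - a\<^sup>2) * (s\<^sup>2 - b\<^sup>2) < 0}"
      by (auto simp: mult_less_0_iff)
    then have "card {t \<in> ?SC - ?SA. a < t \<and> t < b} \<le> card {s \<in> ?SC. (s\<^sup>2 - a\<^sup>2) * (s\<^sup>2 - b\<^sup>2) < 0}"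
      by (rule card_mono[rotated]) (use fin in auto)
    ultimately show "card {t \<in> ?SC - ?SA. a < t \<and> t < b} \<le> 2 * r"
      by linarith
  qed (use fin in auto)
  \<comment> \<open>Splitting both sets along their intersection shows that
    \<open>card ?SC + card (?SA - ?SC)\<close> equals \<open>card (?SC - ?SA) + card ?SA\<close>;
    this is where the subtracted term of the bound arises.\<close>
  moreover have "card ?SC = card (?SC - ?SA) + card (?SA \<inter> ?SC)"
    using card_Diff_subset_Int[of ?SC ?SA] fin card_mono[of ?SC "?SC \<inter> ?SA"] by (simp add: Int_commute)
  moreover have "card ?SA = card (?SA - ?SC) + card (?SA \<inter> ?SC)"
    using card_Diff_subset_Int[of ?SA ?SC] fin card_mono[of ?SA "?SA \<inter> ?SC"] by simp
  ultimately have "card ?SC + card (?SA - ?SC) \<le> 2 * r * card ?SA + card ?SA" by linarith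
  then have "int (card ?SC + card (?SA - ?SC)) \<le> int (2 * r * card ?SA + card ?SA)"
    by (rule of_nat_mono)
  then show ?thesis unfolding r_def by (simp add: algebra_simps)
qed

end
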